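(* Let $H$ be a cone in $\mathscr{V}_NS$ such that $H=\pi_{\downarrow}(H)$. Assume that for every nonzero $y\in\mathbb{R}^N$ the set $$ S_y:=\bigwedge_{S\in H,\ S\ne\{0\}}\frac{S}{S(y)} $$ is absorbing. Then $\pi^{\uparrow}(H)$ is closed with respect to the meet $\wedge$ (intersection). Moreover, $S\in\mathscr{V}_N$ with $S\ne\{0\}$ belongs to $\pi^{\uparrow}(H)$ if and only if $$ S=\bigwedge_{x\in\mathbb{R}^N,\ x\ne 0}S(x)\bigvee_{S_0\in H,\ S_0\neq\{0\}}\frac{S_0}{S_0(x)}. $$
   Context: $\mathscr{V}_N$ is the set of all nonempty compact convex subsets (convex figures) of $\mathbb{R}^N$. A figure $S$ is identified with its support function $S(z)=\sup\{(x,z): x\in S\}$, $z\in\mathbb{R}^N$, where $(\cdot,\cdot)$ is the standard inner product; thus $\mathscr{V}_N$ is a cone (with Minkowski addition and multiplication by nonnegative scalars) in the space $C(S_{N-1})$ of continuous functions on the Euclidean unit sphere $S_{N-1}$. For a real $t$ and a set $A$, $tA=\{ta:a\in A\}$. The join $\bigvee$ is the closed convex hull of the union (its support function is the pointwise supremum), and the meet $\bigwedge$ is intersection. Closedness refers to the Hausdorff metric, i.e. the Chebyshev norm of support functions on $S_{N-1}$. A ball is a symmetric ($S=-S$) absorbing member of $\mathscr{V}_N$. $\mathscr{V}_NS$ is the set of all balls in $\mathbb{R}^N$ together with $\{0\}$; its members are called gauges. The lower hull $\pi_{\downarrow}(H)$ (respectively, the upper hull $\pi^{\uparrow}(H)$)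 is the least closed cone that lies in $\mathscr{V}_NS$, contains $H$, and is closed under the binary meet (respectively, the binary join). Thus $H=\pi_{\downarrow}(H)$ means that $H\subset\mathscr{V}_NS$ is a closed cone containing the intersection of any two of its members. *)

theory Defs
  imports "HOL-Analysis.Analysis" "HOL-Library.Set_Algebras"
begin

definition figures :: "(real ^ 'n) set set" where
  "figures = {S. S \<noteq> {} \<and> compact S \<and> convex S}"

definition supp :: "(real ^ 'n) set \<Rightarrow> real ^ 'n \<Rightarrow> real" where
  "supp S z = (SUP x\<in>S. x \<bullet> z)"

definition absorbing :: "'a::real_vector set \<Rightarrow> bool" where
  "absorbing A \<longleftrightarrow> (\<forall>x. \<exists>r>0. \<forall>t. \<bar>t\<bar> \<le> r \<longrightarrow> t *\<^sub>R x \<in> A)"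

(* Pointwise negation is written as an image, because - S is the complement of S. *)
definition balls :: "(real ^ 'n) set set" where
  "balls = {S \<in> figures. uminus ` S = S \<and> absorbing S}"

definition gauges :: "(real ^ 'n) set set" where
  "gauges = insert {0} balls"

definition join :: "(real ^ 'n) set set \<Rightarrow> (real ^ 'n) set" where
  "join F = closure (convex hull (\<Union>F))"

(* The sum A + B is the Minkowski sum of HOL-Library.Set_Algebras. *)
definition cone_of_figures :: "(real ^ 'n) set set \<Rightarrow> bool" where
  "cone_of_figures K \<longleftrightarrow> K \<subseteq> figures \<and> K \<noteq> {} \<and>
     (\<forall>A\<in>K. \<forall>B\<in>K. A + B \<in> K) \<and> (\<forall>A\<in>K. \<forall>t\<ge>0. (*\<^sub>R) t ` A \<in> K)"

(* Closedness in the space of all figures (not relative to the gauges) for the Chebyshev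
   norm of support functions on the unit sphere.  This metric is the Hausdorff metric, so
   sequences suffice. *)
definition closed_in_figures :: "(real ^ 'n) set set \<Rightarrow> bool" where
  "closed_in_figures K \<longleftrightarrow> (\<forall>S T. (\<forall>n. S n \<in> K) \<and> T \<in> figures \<and>
     uniform_limit (sphere 0 1) (\<lambda>n. supp (S n)) (supp T) sequentially \<longrightarrow> T \<in> K)"

definition lower_closed :: "(real ^ 'n) set set \<Rightarrow> bool" where
  "lower_closed K \<longleftrightarrow> K \<subseteq> gauges \<and> cone_of_figures K \<and> closed_in_figures K \<and>
     (\<forall>A\<in>K. \<forall>B\<in>K. A \<inter> B \<in> K)"

definition upper_closed :: "(real ^ 'n) set set \<Rightarrow> bool" where
  "upper_closed K \<longleftrightarrow> K \<subseteq> gauges \<and> cone_of_figures K \<and> closed_in_figures K \<and>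
     (\<forall>A\<in>K. \<forall>B\<in>K. join {A, B} \<in> K)"

(* The library operator P hull H is the intersection of all supersets of H satisfying P.
   The set of gauges is not closed (balls can converge to a segment), so for some H no
   closed cone of gauges contains H, and then the hull has the junk value UNIV.  Whenever
   such a cone exists, the hull is the least one; see the lemmas below. *)
definition lower_hull :: "(real ^ 'n) set set \<Rightarrow> (real ^ 'n) set set" where
  "lower_hull H = lower_closed hull H"

definition upper_hull :: "(real ^ 'n) set set \<Rightarrow> (real ^ 'n) set set" where
  "upper_hull H = upper_closed hull H"

lemma zero_in_cone:
  assumes "cone_of_figures K"
  shows "{0} \<in> K"
proof -
  obtain A where A: "A \<in> K" "A \<noteq> {}"
    using assms by (fastforce simp: cone_of_figures_def figures_def)
  have "(*\<^sub>R) 0 ` A \<in> K"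
    using A assms unfolding cone_of_figures_def by blast
  moreover have "(*\<^sub>R) 0 ` A = {0}"
    using A(2) by auto
  ultimately show ?thesis by simp
qed

lemma cone_of_figures_Inter:
  assumes "F \<noteq> {}" "\<And>K. K \<in> F \<Longrightarrow> cone_of_figures K"
  shows "cone_of_figures (\<Inter>F)"
proof -
  have K: "K \<subseteq> figures" "\<And>A B. A \<in> K \<Longrightarrow> B \<in> K \<Longrightarrow> A + B \<in> K"
    "\<And>A t. A \<in> K \<Longrightarrow> t \<ge> 0 \<Longrightarrow> (*\<^sub>R) t ` A \<in> K" if "K \<in> F" for K
    using assms(2)[OF that] by (simp_all add: cone_of_figures_def)
  have "\<Inter>F \<noteq> {}" using assms(2) zero_in_cone by blast
  moreover have "\<Inter>F \<subseteq> figures" using assms(1) K(1) by blast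
  ultimately show ?thesis using K(2,3) by (simp add: cone_of_figures_def)
qed

lemma closed_in_figures_Inter:
  assumes "\<And>K. K \<in> F \<Longrightarrow> closed_in_figures K"
  shows "closed_in_figures (\<Inter>F)"
  using assms unfolding closed_in_figures_def by blast

lemma lower_closed_Inter:
  assumes "F \<noteq> {}" "\<And>K. K \<in> F \<Longrightarrow> lower_closed K"
  shows "lower_closed (\<Inter>F)"
proof -
  have K: "K \<subseteq> gauges" "cone_of_figures K" "closed_in_figures K"
    "\<And>A B. A \<in> K \<Longrightarrow> B \<in> K \<Longrightarrow> A \<inter> B \<in> K" if "K \<in> F" for K
    using assms(2)[OF that] by (simp_all add: lower_closed_def)
  have "\<Inter>F \<subseteq> gauges" using assms(1) K(1) by blast
  moreover have "cone_of_figures (\<Inter>F)" by (rule cone_of_figures_Inter[OF assms(1) K(2)])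
  moreover have "closed_in_figures (\<Inter>F)" by (rule closed_in_figures_Inter[OF K(3)])
  moreover have "\<forall>A\<in>\<Inter>F. \<forall>B\<in>\<Inter>F. A \<inter> B \<in> \<Inter>F"
    using K(4) by simp
  ultimately show ?thesis by (simp add: lower_closed_def)
qed

lemma upper_closed_Inter:
  assumes "F \<noteq> {}" "\<And>K. K \<in> F \<Longrightarrow> upper_closed K"
  shows "upper_closed (\<Inter>F)"
proof -
  have K: "K \<subseteq> gauges" "cone_of_figures K" "closed_in_figures K"
    "\<And>A B. A \<in> K \<Longrightarrow> B \<in> K \<Longrightarrow> join {A, B} \<in> K" if "K \<in> F" for K
    using assms(2)[OF that] by (simp_all add: upper_closed_def)
  have "\<Inter>F \<subseteq> gauges" using assms(1) K(1) by blast
  moreover have "cone_of_figures (\<Inter>F)" by (rule cone_of_figures_Inter[OF assms(1) K(2)])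
  moreover have "closed_in_figures (\<Inter>F)" by (rule closed_in_figures_Inter[OF K(3)])
  moreover have "\<forall>A\<in>\<Inter>F. \<forall>B\<in>\<Inter>F. join {A, B} \<in> \<Inter>F"
    using K(4) by simp
  ultimately show ?thesis by (simp add: upper_closed_def)
qed

lemma lower_hull_least:
  assumes "lower_closed K" "H \<subseteq> K"
  shows "lower_closed (lower_hull H)" "H \<subseteq> lower_hull H" "lower_hull H \<subseteq> K"
proof -
  show "lower_closed (lower_hull H)"
    unfolding lower_hull_def hull_def by (rule lower_closed_Inter) (use assms in blast)+
  show "H \<subseteq> lower_hull H" "lower_hull H \<subseteq> K"
    unfolding lower_hull_def hull_def using assms by blast+
qed

lemma upper_hull_least:
  assumes "upper_closed K" "H \<subseteq> K"
  shows "upper_closed (upper_hull H)" "H \<subseteq> upper_hull H" "upper_hull H \<subseteq> K"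
proof -
  show "upper_closed (upper_hull H)"
    unfolding upper_hull_def hull_def by (rule upper_closed_Inter) (use assms in blast)+
  show "H \<subseteq> upper_hull H" "upper_hull H \<subseteq> K"
    unfolding upper_hull_def hull_def using assms by blast+
qed

lemma lower_hull_fixed_iff:
  assumes "H \<subseteq> gauges"
  shows "H = lower_hull H \<longleftrightarrow> lower_closed H"
proof
  assume H: "H = lower_hull H"
  have "{} \<notin> (gauges :: (real ^ 'n) set set)"
    unfolding gauges_def balls_def figures_def by blast
  then have "{} \<notin> lower_hull H" using assms H by auto
  then obtain K where "lower_closed K" "H \<subseteq> K"
    unfolding lower_hull_def hull_def by blast
  then have "lower_closed (lower_hull H)" by (rule lower_hull_least(1))
  then show "lower_closed H" using H by simp
next
  assume "lower_closed H"
  then show "H = lower_hull H"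
    using lower_hull_least(2,3)[of H H] by (intro equalityI) simp_all
qed

end

theory Submission
  imports Defs
begin

text \<open>
  A figure \<open>S\<close> lies in the upper hull of \<open>H\<close> iff it is filled from inside by members of \<open>H\<close>:
  for all \<open>p \<in> S\<close> and \<open>0 \<le> t < 1\<close> some \<open>A \<in> H\<close> satisfies \<open>t p \<in> A \<subseteq> S\<close>. The factor \<open>t\<close> leaves the
  room needed for passing to limits and for compactness arguments. Every point of \<open>A \<or> B\<close> lies in
  a combination \<open>u A + v B\<close> with \<open>u + v = 1\<close>, so this property is stable under joins; it is
  stable under meets because \<open>H\<close> is. A limit of filled figures is again a ball, or zero, because
  they satisfy the Harnack inequality \<open>S(y) S\<^sub>y \<subseteq> S\<close>.

  If \<open>S\<close> is the meet in the theorem, then for each \<open>x\<close> the point \<open>t p\<close> lies in some \<open>A\<^sub>x \<in> H\<close> with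
  \<open>A\<^sub>x(x) \<le> S(x)\<close>; finitely many of the half-spaces \<open>{q. (q, x) \<le> S(x)}\<close> cut out a set inside
  \<open>(1 + \<epsilon>) S\<close>, and the intersection of the corresponding \<open>A\<^sub>x\<close> fills \<open>(1 + \<epsilon>) S\<close> at \<open>t p\<close>.
\<close>

section \<open>Support functions of figures\<close>

lemma figuresD:
  assumes "S \<in> figures"
  shows "S \<noteq> {}" "compact S" "convex S" "closed S"
  using assms by (auto simp: figures_def compact_imp_closed)

lemma bdd_above_inner:
  assumes "compact S"
  shows "bdd_above ((\<lambda>p. p \<bullet> x) ` S)"
  by (intro bounded_imp_bdd_above compact_imp_bounded compact_continuous_image
      continuous_intros assms)

lemma inner_le_supp:
  assumes "compact S" "p \<in> S"
  shows "p \<bullet> x \<le> supp S x"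
  unfolding supp_def by (rule cSUP_upper[OF assms(2) bdd_above_inner[OF assms(1)]])

lemma supp_le:
  assumes "S \<noteq> {}" "\<And>p. p \<in> S \<Longrightarrow> p \<bullet> x \<le> c"
  shows "supp S x \<le> c"
  unfolding supp_def by (rule cSUP_least[OF assms])

lemma supp_mono:
  assumes "A \<subseteq> B" "A \<noteq> {}" "compact B"
  shows "supp A x \<le> supp B x"
  by (rule supp_le) (use assms inner_le_supp in auto)

lemma supp_attained:
  assumes "S \<in> figures"
  obtains p where "p \<in> S" "p \<bullet> x = supp S x"
proof -
  note S = figuresD[OF assms]
  have "continuous_on S (\<lambda>p. p \<bullet> x)" by (intro continuous_intros)
  from continuous_attains_sup[OF S(2,1) this]
  obtain p where p: "p \<in> S" "\<forall>q\<in>S. q \<bullet> x \<le> p \<bullet> x" by blast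
  have "supp S x = p \<bullet> x"
    using p by (intro antisym supp_le inner_le_supp S) auto
  with p(1) that show ?thesis by simp
qed

lemma separating_supp:
  assumes "S \<in> figures" "q \<notin> S"
  obtains x where "x \<noteq> 0" "norm x = 1" "supp S x < q \<bullet> x"
proof -
  note S = figuresD[OF assms(1)]
  obtain a b where ab: "a \<bullet> q < b" "\<And>p. p \<in> S \<Longrightarrow> b < a \<bullet> p"
    using separating_hyperplane_closed_point[OF S(3,4) assms(2)] by blast
  have a: "a \<noteq> 0" using ab S(1) by force
  \<comment> \<open>The separating hyperplane has \<open>q\<close> on the low side and
    \<open>S\<close> on the high side of \<open>a\<close>, so the outer normal is
    \<open>- a\<close>. It is normalized because figures are compared on the unit sphere.\<close>
  define x where "x = - (1 / norm a) *\<^sub>R a"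
  have x: "norm x = 1" "x \<noteq> 0" using a by (auto simp: x_def)
  have "supp S x \<le> - b / norm a"
    using ab(2) a by (intro supp_le S)
      (auto simp: x_def inner_commute divide_simps less_imp_le)
  also have "\<dots> < q \<bullet> x"
    using ab(1) a by (simp add: x_def inner_commute divide_simps)
  finally show ?thesis using that x by blast
qed

lemma mem_figure_if_inner_le:
  assumes "S \<in> figures" "\<And>x. norm x = 1 \<Longrightarrow> q \<bullet> x \<le> supp S x"
  shows "q \<in> S"
  using assms separating_supp by (metis not_less)

section \<open>Shrinking towards the origin, and the origin as an interior point\<close>

lemma scaleR_mem_convex:
  fixes S :: "'a::real_vector set"
  assumes "convex S" "0 \<in> S" "p \<in> S" "0 \<le> t" "t \<le> 1"
  shows "t *\<^sub>R p \<in> S"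
  using convexD[OF assms(1,3,2), of t "1 - t"] assms(4,5) by simp

lemma scaleR_mem_convex_le:
  fixes S :: "'a::real_vector set"
  assumes "convex S" "0 \<in> S" "b *\<^sub>R p \<in> S" "0 \<le> a" "a \<le> b"
  shows "a *\<^sub>R p \<in> S"
proof (cases "b = 0")
  case False
  then have "(a / b) *\<^sub>R (b *\<^sub>R p) \<in> S"
    using assms by (intro scaleR_mem_convex[of S "b *\<^sub>R p"]) (auto simp: divide_simps)
  then show ?thesis using False by simp
qed (use assms in simp)

text \<open>This removes the factor \<open>t < 1\<close> built into filled figures: \<open>p\<close>
  is the limit of its shrunken copies as \<open>t\<close> tends to 1 from the left.\<close>

lemma closed_scaleR_lim:
  fixes S :: "'a::real_normed_vector set"
  assumes "closed S" "\<And>t. 0 < t \<Longrightarrow> t < 1 \<Longrightarrow> t *\<^sub>R p \<in> S"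
  shows "p \<in> S"
proof -
  have "((\<lambda>t. t *\<^sub>R p) \<longlongrightarrow> 1 *\<^sub>R p) (at_left (1::real))"
    by (intro tendsto_intros)
  moreover have "eventually (\<lambda>t. t *\<^sub>R p \<in> S) (at_left (1::real))"
    using eventually_at_left_real[of 0 "1::real", OF zero_less_one] by (rule eventually_mono) (use assms(2) in auto)
  ultimately have "1 *\<^sub>R p \<in> S"
    by (intro Lim_in_closed_set[OF assms(1), where F = "at_left (1::real)"]) auto
  then show ?thesis by simp
qed

lemma scaleR_mem_interior:
  fixes S :: "'a::euclidean_space set"
  assumes "convex S" "0 \<in> interior S" "p \<in> closure S" "0 \<le> t" "t < 1"
  shows "t *\<^sub>R p \<in> interior S"
  using mem_interior_closure_convex_shrink[OF assms(1-3), of "1 - t"] assms(4,5)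
  by (simp add: algebra_simps)

text \<open>It suffices to absorb the finitely many basis vectors: every short vector is a convex
  combination of small multiples of them.\<close>

lemma zero_mem_interior_absorbing:
  fixes S :: "'a::euclidean_space set"
  assumes "convex S" "absorbing S"
  shows "0 \<in> interior S"
proof -
  obtain r where r: "\<And>x. r x > 0" "\<And>x t. \<bar>t\<bar> \<le> r x \<Longrightarrow> t *\<^sub>R x \<in> S"
    using assms(2) unfolding absorbing_def by metis
  define \<rho> where "\<rho> = Min (r ` (Basis :: 'a set))"
  have \<rho>: "\<rho> > 0" "\<And>b. b \<in> Basis \<Longrightarrow> \<rho> \<le> r b"
    by (auto simp: \<rho>_def r(1))
  define d where "d = real DIM('a)"
  have d: "d > 0" by (simp add: d_def)
  have "v \<in> S" if v: "norm v < \<rho> / d" for v :: 'a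
  proof -
    \<comment> \<open>Equal weights \<open>1 / d\<close> turn the coordinate expansion into a convex
      combination. The compensating factor \<open>d\<close> in the points explains the radius
      \<open>\<rho> / d\<close>.\<close>
    have "(\<Sum>b\<in>Basis. (1 / d) *\<^sub>R ((d * (v \<bullet> b)) *\<^sub>R b)) \<in> S"
    proof (rule convex_sum[OF _ assms(1)])
      fix b :: 'a assume b: "b \<in> Basis"
      have "\<bar>v \<bullet> b\<bar> \<le> \<rho> / d" using v Basis_le_norm[OF b, of v] by linarith
      then have "\<bar>d * (v \<bullet> b)\<bar> \<le> r b"
        using \<rho>(2)[OF b] d by (simp add: abs_mult pos_le_divide_eq mult.commute)
      then show "(d * (v \<bullet> b)) *\<^sub>R b \<in> S" by (rule r(2))
    qed (use d in \<open>auto simp: d_def\<close>)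
    also have "(\<Sum>b\<in>Basis. (1 / d) *\<^sub>R ((d * (v \<bullet> b)) *\<^sub>R b)) = v"
      using d by (simp add: euclidean_representation)
    finally show ?thesis .
  qed
  then have "ball 0 (\<rho> / d) \<subseteq> S" by auto
  with \<rho>(1) d show ?thesis
    by (meson centre_in_ball divide_pos_pos interior_maximal open_ball subsetD)
qed

lemma zero_mem_interior_scaleR:
  fixes A :: "'a::real_normed_vector set"
  assumes "0 \<in> interior A" "c \<noteq> 0" "(*\<^sub>R) c ` A \<subseteq> B"
  shows "0 \<in> interior B"
proof (rule interiorI)
  show "open ((*\<^sub>R) c ` interior A)" using open_scaling[OF assms(2) open_interior] .
  show "0 \<in> (*\<^sub>R) c ` interior A" by (rule image_eqI[OF _ assms(1)]) simp
  show "(*\<^sub>R) c ` interior A \<subseteq> B"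
    by (rule order_trans[OF image_mono[OF interior_subset] assms(3)])
qed

lemma absorbing_if_zero_mem_interior:
  fixes S :: "'a::real_normed_vector set"
  assumes "0 \<in> interior S"
  shows "absorbing S"
  unfolding absorbing_def
proof
  fix x :: 'a
  obtain e where e: "e > 0" "ball 0 e \<subseteq> S"
    using assms by (auto simp: mem_interior)
  have "t *\<^sub>R x \<in> S" if "\<bar>t\<bar> \<le> e / (norm x + 1)" for t
  proof -
    have "\<bar>t\<bar> * norm x \<le> e / (norm x + 1) * norm x"
      using that by (intro mult_right_mono) auto
    also have "\<dots> < e"
      using e(1) by (simp add: divide_simps add_nonneg_pos)
    finally show ?thesis using e(2) by (auto simp: subset_iff)
  qed
  moreover have "e / (norm x + 1) > 0" using e(1) by (simp add: add_nonneg_pos)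
  ultimately show "\<exists>r>0. \<forall>t. \<bar>t\<bar> \<le> r \<longrightarrow> t *\<^sub>R x \<in> S" by blast
qed

section \<open>Positive support functions and approximation by finitely many half-spaces\<close>

lemma supp_pos:
  fixes S :: "(real ^ 'n) set"
  assumes "compact S" "0 \<in> interior S" "x \<noteq> 0"
  shows "0 < supp S x"
proof -
  obtain r where r: "r > 0" "r *\<^sub>R x \<in> S"
    using absorbing_if_zero_mem_interior[OF assms(2)] unfolding absorbing_def
    by (metis abs_of_pos order_refl)
  have "0 < (r *\<^sub>R x) \<bullet> x" using r(1) assms(3) by simp
  also have "\<dots> \<le> supp S x" by (rule inner_le_supp[OF assms(1) r(2)])
  finally show ?thesis .
qed

text \<open>If 0 were not interior, some hyperplane through 0 would support \<open>S\<close>, and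
  the support function would be at most 0 at its outer normal \<open>- a\<close>.\<close>

lemma zero_mem_interior_if_supp_pos:
  fixes S :: "(real ^ 'n) set"
  assumes "S \<in> figures" "\<And>x. x \<noteq> 0 \<Longrightarrow> 0 < supp S x"
  shows "0 \<in> interior S"
proof (rule ccontr)
  note S = figuresD[OF assms(1)]
  assume 0: "0 \<notin> interior S"
  have "0 \<in> S"
    using assms(2) by (intro mem_figure_if_inner_le[OF assms(1)]) 
      (metis inner_zero_left less_imp_le norm_zero zero_neq_one)
  \<comment> \<open>With empty interior, \<open>S\<close> lies in a hyperplane, which passes through
    0 because 0 is in \<open>S\<close>. Otherwise the relative interior is the interior, and
    \<open>S\<close> has a supporting hyperplane at 0.\<close>
  obtain a where a: "a \<noteq> 0" "\<And>y. y \<in> S \<Longrightarrow> 0 \<le> a \<bullet> y"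
  proof (cases "interior S = {}")
    case True
    then obtain a b where ab: "a \<noteq> 0" "S \<subseteq> {x. a \<bullet> x = b}"
      using empty_interior_subset_hyperplane[OF S(3)] by blast
    then have "b = 0" using \<open>0 \<in> S\<close> by auto
    with ab that[of a] show ?thesis by force
  next
    case False
    then have "0 \<notin> rel_interior S" using 0 by (simp add: rel_interior_nonempty_interior)
    then obtain a where "a \<noteq> 0" "\<And>y. y \<in> closure S \<Longrightarrow> a \<bullet> 0 \<le> a \<bullet> y"
      using supporting_hyperplane_relative_frontier[OF S(3), of 0] \<open>0 \<in> S\<close> closure_subset
      by (metis subsetD)
    with that closure_subset[of S] show ?thesis by (auto simp: subset_iff)
  qed
  have "supp S (- a) \<le> 0"
    using a(2) by (intro supp_le S) (auto simp: inner_commute)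
  then show False using assms(2)[of "- a"] a(1) by simp
qed

text \<open>Dilating a frontier point by \<open>1 + e\<close> moves it out of \<open>S\<close>, so
  an open half-space condition holds near it; compactness of the frontier leaves finitely many
  conditions. A point outside the dilated figure is excluded where its segment to 0 crosses the
  frontier.\<close>

lemma finite_halfspaces_approx:
  fixes S :: "(real ^ 'n) set"
  assumes "S \<in> figures" "0 \<in> interior S" "e > 0"
  obtains X where "finite X" "0 \<notin> X"
    "\<And>q. (\<And>x. x \<in> X \<Longrightarrow> q \<bullet> x \<le> supp S x) \<Longrightarrow> (1 / (1 + e)) *\<^sub>R q \<in> S"
proof -
  note S = figuresD[OF assms(1)]
  have "0 \<in> S" using assms(2) interior_subset by blast
  have supp: "0 \<le> supp S x" for x
    using inner_le_supp[OF S(2) \<open>0 \<in> S\<close>, of x] by simp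
  define O' where "O' x = {q. supp S x < (1 + e) * (q \<bullet> x)}" for x
  have "open (O' x)" for x
    unfolding O'_def by (intro open_Collect_less continuous_intros)
  moreover have "compact (frontier S)" using S(2) by (rule compact_frontier)
  moreover have "frontier S \<subseteq> (\<Union>x\<in>-{0}. O' x)"
  proof
    fix q assume q: "q \<in> frontier S"
    have "(1 + e) *\<^sub>R q \<notin> S"
    proof
      assume "(1 + e) *\<^sub>R q \<in> S"
      then have "(1 / (1 + e)) *\<^sub>R ((1 + e) *\<^sub>R q) \<in> interior S"
        using assms(3) closure_subset[of S] by (intro scaleR_mem_interior S assms(2)) auto
      then have "q \<in> interior S" using assms(3) by (simp add: divide_simps)
      with q show False by (simp add: frontier_def)
    qed
    then obtain x where "x \<noteq> 0" "supp S x < ((1 + e) *\<^sub>R q) \<bullet> x"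
      using separating_supp[OF assms(1)] by metis
    then show "q \<in> (\<Union>x\<in>-{0}. O' x)" by (auto simp: O'_def)
  qed
  ultimately obtain X where X: "X \<subseteq> -{0}" "finite X" "frontier S \<subseteq> (\<Union>x\<in>X. O' x)"
    using compactE_image[of "frontier S" "-{0}" O'] by metis
  have "(1 / (1 + e)) *\<^sub>R q \<in> S" if q: "\<And>x. x \<in> X \<Longrightarrow> q \<bullet> x \<le> supp S x" for q
  proof (rule ccontr)
    let ?w = "(1 / (1 + e)) *\<^sub>R q"
    assume "?w \<notin> S"
    then have "closed_segment 0 ?w \<inter> frontier S \<noteq> {}"
      using \<open>0 \<in> S\<close> by (intro connected_Int_frontier) auto
    then obtain u where u: "0 \<le> u" "u \<le> 1" "u *\<^sub>R ?w \<in> frontier S"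
      by (auto simp: in_segment)
    then obtain x where x: "x \<in> X" "u *\<^sub>R ?w \<in> O' x" using X(3) by blast
    \<comment> \<open>The factor \<open>1 + e\<close> in \<open>O'\<close> cancels the
      \<open>1 / (1 + e)\<close> in \<open>?w\<close>.\<close>
    have "supp S x < u * (q \<bullet> x)"
      using x(2) assms(3) by (simp add: O'_def)
    also have "\<dots> \<le> u * supp S x" by (intro mult_left_mono q x u)
    also have "\<dots> \<le> supp S x" using u(2) supp[of x] by (simp add: mult_left_le_one_le u(1))
    finally show False by simp
  qed
  with X that show ?thesis by blast
qed

section \<open>Sums, multiples and joins of figures; gauges\<close>

lemma figures_plus:
  fixes A B :: "(real ^ 'n) set"
  assumes "A \<in> figures" "B \<in> figures"
  shows "A + B \<in> figures"
proof -
  have "A + B = {x + y |x y. x \<in> A \<and> y \<in> B}" by (auto simp: set_plus_def)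
  then show ?thesis
    using assms compact_sums[of A B] convex_set_plus[of A B]
    by (auto simp: figures_def)
qed

lemma figures_scaleR:
  fixes A :: "(real ^ 'n) set"
  assumes "A \<in> figures"
  shows "(*\<^sub>R) t ` A \<in> figures"
  using assms compact_scaling[of A t] convex_scaling[of A t] by (auto simp: figures_def)

text \<open>The convex hull of a compact union is compact, hence equal to its closure, and its
  points are explicit two-term combinations.\<close>

lemma join_pair:
  fixes A B :: "(real ^ 'n) set"
  assumes "A \<in> figures" "B \<in> figures"
  shows "join {A, B} \<in> figures"
    and "p \<in> join {A, B} \<longleftrightarrow>
      (\<exists>u v a b. 0 \<le> u \<and> 0 \<le> v \<and> u + v = 1 \<and> a \<in> A \<and> b \<in> B \<and> p = u *\<^sub>R a + v *\<^sub>R b)"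
proof -
  note AB = figuresD[OF assms(1)] figuresD[OF assms(2)]
  have "compact (convex hull (A \<union> B))"
    by (intro compact_convex_hull compact_Un AB)
  then have *: "join {A, B} = convex hull (A \<union> B)"
    by (simp add: join_def closure_closed compact_imp_closed)
  show "join {A, B} \<in> figures"
    using \<open>compact (convex hull (A \<union> B))\<close> AB by (simp add: * figures_def)
  show "p \<in> join {A, B} \<longleftrightarrow>
      (\<exists>u v a b. 0 \<le> u \<and> 0 \<le> v \<and> u + v = 1 \<and> a \<in> A \<and> b \<in> B \<and> p = u *\<^sub>R a + v *\<^sub>R b)"
    unfolding * convex_hull_union_two[OF AB(3,1,7,5)] by blast
qed

lemma join_pair_least:
  assumes "A \<subseteq> S" "B \<subseteq> S" "closed S" "convex S"
  shows "join {A, B} \<subseteq> S"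
  unfolding join_def using assms by (intro closure_minimal hull_minimal) auto

lemma join_upper:
  assumes "A \<in> F"
  shows "A \<subseteq> join F"
proof -
  have "A \<subseteq> \<Union>F" using assms by blast
  also have "\<dots> \<subseteq> convex hull (\<Union>F)" by (rule hull_subset)
  also have "\<dots> \<subseteq> join F" unfolding join_def by (rule closure_subset)
  finally show ?thesis .
qed

lemma gaugesD:
  assumes "A \<in> gauges"
  shows "A \<in> figures" "uminus ` A = A" "0 \<in> A" "A \<noteq> {0} \<Longrightarrow> 0 \<in> interior A"
proof -
  show "A \<in> figures" "uminus ` A = A"
    using assms by (auto simp: gauges_def balls_def figures_def)
  have *: "0 \<in> interior A" if "A \<noteq> {0}"
    using assms that zero_mem_interior_absorbing[of A]
    by (auto simp: gauges_def balls_def figures_def)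
  then show "0 \<in> A" using interior_subset by (cases "A = {0}") auto
  show "A \<noteq> {0} \<Longrightarrow> 0 \<in> interior A" by (rule *)
qed

lemma ball_if_zero_mem_interior:
  fixes A :: "(real ^ 'n) set"
  assumes "A \<in> figures" "\<And>p. p \<in> A \<Longrightarrow> - p \<in> A" "0 \<in> interior A"
  shows "A \<in> gauges"
proof -
  have "uminus ` A = A"
    using assms(2) by (force simp: image_iff intro: exI[of _ "- x" for x])
  then show ?thesis
    using assms absorbing_if_zero_mem_interior[OF assms(3)] by (simp add: gauges_def balls_def)
qed

section \<open>Figures filled by a meet-closed cone\<close>

definition filled :: "(real ^ 'n) set set \<Rightarrow> (real ^ 'n) set set" where
  "filled H = {S \<in> figures. \<forall>p\<in>S. \<forall>t. 0 \<le> t \<and> t < 1 \<longrightarrow> (\<exists>A\<in>H. t *\<^sub>R p \<in> A \<and> A \<subseteq> S)}"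

lemma filledD:
  assumes "S \<in> filled H"
  shows "S \<in> figures" "\<And>p t. p \<in> S \<Longrightarrow> 0 \<le> t \<Longrightarrow> t < 1 \<Longrightarrow> \<exists>A\<in>H. t *\<^sub>R p \<in> A \<and> A \<subseteq> S"
  using assms by (auto simp: filled_def)

text \<open>The assumption \<open>harnack\<close> bounds the members of \<open>H\<close> from below:
  for fixed \<open>y\<close>, a common neighbourhood of 0, scaled by \<open>supp S y\<close>, fits
  into every nonzero \<open>S\<close> in \<open>H\<close>. For \<open>H = {{0}}\<close> the
  intersection is \<open>UNIV\<close>.\<close>

locale harnack_cone =
  fixes H :: "(real ^ 'n) set set"
  assumes cone: "cone_of_figures H"
    and gauges: "H \<subseteq> gauges"
    and meet: "\<And>A B. A \<in> H \<Longrightarrow> B \<in> H \<Longrightarrow> A \<inter> B \<in> H"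
    and harnack: "\<And>y. y \<noteq> 0 \<Longrightarrow> absorbing (\<Inter>S\<in>H - {{0}}. (*\<^sub>R) (1 / supp S y) ` S)"
begin

lemma plus: "A \<in> H \<Longrightarrow> B \<in> H \<Longrightarrow> A + B \<in> H"
  and scale: "A \<in> H \<Longrightarrow> 0 \<le> t \<Longrightarrow> (*\<^sub>R) t ` A \<in> H"
  using cone by (auto simp: cone_of_figures_def)

lemma zero_mem: "{0} \<in> H"
  by (rule zero_in_cone[OF cone])

lemmas H_D = gaugesD[OF subsetD[OF gauges]]

lemma supp_pos_H:
  assumes "A \<in> H" "A \<noteq> {0}" "x \<noteq> 0"
  shows "0 < supp A x"
  using supp_pos[OF figuresD(2)[OF H_D(1)] H_D(4)] assms by blast

lemma subset_filled: "H \<subseteq> filled H"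
proof
  fix A assume A: "A \<in> H"
  note F = figuresD[OF H_D(1)[OF A]]
  have "t *\<^sub>R p \<in> A" if "p \<in> A" "0 \<le> t" "t < 1" for p t
    using that by (intro scaleR_mem_convex F H_D(3)[OF A]) auto
  then show "A \<in> filled H" using A H_D(1)[OF A] by (auto simp: filled_def)
qed

text \<open>The case \<open>t = 0\<close> yields a member of \<open>H\<close> inside
  \<open>S\<close>, and every gauge contains 0.\<close>

lemma filled_zero: "S \<in> filled H \<Longrightarrow> 0 \<in> S"
  using filledD[of S H] figuresD(1)[of S] H_D(3)
  by (metis all_not_in_conv order_refl subsetD zero_less_one)

lemma filled_nonzero:
  assumes "S \<in> filled H" "S \<noteq> {0}"
  obtains A where "A \<in> H" "A \<noteq> {0}" "A \<subseteq> S"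
proof -
  note S = filledD[OF assms(1)]
  obtain p where p: "p \<in> S" "p \<noteq> 0" using assms filled_zero by blast
  then obtain A where "A \<in> H" "(1/2) *\<^sub>R p \<in> A" "A \<subseteq> S"
    using S(2)[of p "1/2"] by auto
  with p that show ?thesis by force
qed

lemma filled_zero_interior:
  assumes "S \<in> filled H" "S \<noteq> {0}"
  shows "0 \<in> interior S"
  using filled_nonzero[OF assms] H_D(4) interior_mono by (metis subsetD)

text \<open>Symmetry passes from the members of \<open>H\<close> inside \<open>S\<close> to
  \<open>S\<close> itself by letting \<open>t\<close> tend to 1.\<close>

lemma filled_gauges: "filled H \<subseteq> gauges"
proof
  fix S assume S: "S \<in> filled H"
  show "S \<in> gauges"
  proof (cases "S = {0}")
    case False
    have "- p \<in> S" if p: "p \<in> S" for p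
    proof (rule closed_scaleR_lim)
      show "closed S" using figuresD(4) filledD(1)[OF S] .
    next
      fix t :: real assume t: "0 < t" "t < 1"
      then obtain A where A: "A \<in> H" "t *\<^sub>R p \<in> A" "A \<subseteq> S"
        using filledD(2)[OF S p, of t] by auto
      have "- (t *\<^sub>R p) \<in> A" using A(2) H_D(2)[OF A(1)] by blast
      with A(3) show "t *\<^sub>R (- p) \<in> S" by auto
    qed
    then show ?thesis
      by (rule ball_if_zero_mem_interior[OF filledD(1)[OF S] _ filled_zero_interior[OF S False]])
  qed (simp add: gauges_def)
qed

section \<open>Stability of filled figures under sums, multiples, join and meet\<close>

lemma filled_plus:
  assumes "S \<in> filled H" "T \<in> filled H"
  shows "S + T \<in> filled H"
proof -
  have "\<exists>A\<in>H. t *\<^sub>R r \<in> A \<and> A \<subseteq> S + T" if r: "r \<in> S + T" and t: "0 \<le> t" "t < 1" for r t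
  proof -
    obtain p q where pq: "p \<in> S" "q \<in> T" "r = p + q"
      using r by (auto elim: set_plus_elim)
    obtain A B where AB: "A \<in> H" "t *\<^sub>R p \<in> A" "A \<subseteq> S" "B \<in> H" "t *\<^sub>R q \<in> B" "B \<subseteq> T"
      using filledD(2)[OF assms(1) pq(1) t] filledD(2)[OF assms(2) pq(2) t] by blast
    have "t *\<^sub>R r \<in> A + B" unfolding pq(3) scaleR_add_right using AB by blast
    moreover have "A + B \<subseteq> S + T" using AB by (intro set_plus_mono2) auto
    ultimately show ?thesis using plus AB by blast
  qed
  then show ?thesis
    using figures_plus filledD(1) assms by (auto simp: filled_def)
qed

lemma filled_scale:
  assumes "S \<in> filled H" "0 \<le> c"
  shows "(*\<^sub>R) c ` S \<in> filled H"
proof -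
  have "\<exists>A\<in>H. t *\<^sub>R (c *\<^sub>R p) \<in> A \<and> A \<subseteq> (*\<^sub>R) c ` S"
    if p: "p \<in> S" and t: "0 \<le> t" "t < 1" for p t
  proof -
    obtain A where A: "A \<in> H" "t *\<^sub>R p \<in> A" "A \<subseteq> S"
      using filledD(2)[OF assms(1) p t] by blast
    then have "c *\<^sub>R (t *\<^sub>R p) \<in> (*\<^sub>R) c ` A" "(*\<^sub>R) c ` A \<subseteq> (*\<^sub>R) c ` S" by blast+
    then show ?thesis using scale[OF A(1) assms(2)] by (metis scaleR_left_commute)
  qed
  then show ?thesis
    using figures_scaleR filledD(1)[OF assms(1)] by (auto simp: filled_def)
qed

lemma filled_cone: "cone_of_figures (filled H)"
  using filledD(1) subset_filled zero_mem filled_plus filled_scale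
  unfolding cone_of_figures_def by (auto simp: subset_iff)

lemma filled_join:
  assumes "S \<in> filled H" "T \<in> filled H"
  shows "join {S, T} \<in> filled H"
proof -
  note ST = filledD(1)[OF assms(1)] filledD(1)[OF assms(2)]
  have "\<exists>A\<in>H. t *\<^sub>R r \<in> A \<and> A \<subseteq> join {S, T}"
    if r: "r \<in> join {S, T}" and t: "0 \<le> t" "t < 1" for r t
  proof -
    obtain u v p q where uv: "0 \<le> u" "0 \<le> v" "u + v = 1"
      and pq: "p \<in> S" "q \<in> T" "r = u *\<^sub>R p + v *\<^sub>R q"
      using r unfolding join_pair(2)[OF ST] by blast
    obtain A B where AB: "A \<in> H" "t *\<^sub>R p \<in> A" "A \<subseteq> S" "B \<in> H" "t *\<^sub>R q \<in> B" "B \<subseteq> T"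
      using filledD(2)[OF assms(1) pq(1) t] filledD(2)[OF assms(2) pq(2) t] by blast
    \<comment> \<open>\<open>H\<close> need not contain the join of \<open>A\<close> and
      \<open>B\<close>. This weighted sum takes its place: it lies in the cone \<open>H\<close>, and
      in the join of \<open>S\<close> and \<open>T\<close> because \<open>u + v = 1\<close>.\<close>
    let ?C = "(*\<^sub>R) u ` A + (*\<^sub>R) v ` B"
    have "u *\<^sub>R (t *\<^sub>R p) + v *\<^sub>R (t *\<^sub>R q) \<in> ?C" by (intro set_plus_intro imageI AB)
    then have "t *\<^sub>R r \<in> ?C" by (simp add: pq(3) scaleR_add_right mult.commute)
    moreover have "?C \<in> H" using AB uv by (intro plus scale)
    moreover have "?C \<subseteq> join {S, T}"
    proof
      fix z assume "z \<in> ?C"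
      then obtain a b where "a \<in> S" "b \<in> T" "z = u *\<^sub>R a + v *\<^sub>R b"
        using AB by (auto simp: set_plus_def)
      with uv show "z \<in> join {S, T}" unfolding join_pair(2)[OF ST] by blast
    qed
    ultimately show ?thesis by blast
  qed
  then show ?thesis using join_pair(1)[OF ST] by (auto simp: filled_def)
qed

lemma filled_meet:
  assumes "S \<in> filled H" "T \<in> filled H"
  shows "S \<inter> T \<in> filled H"
proof -
  have "S \<inter> T \<in> figures"
    using figuresD[OF filledD(1)[OF assms(1)]] figuresD[OF filledD(1)[OF assms(2)]]
      filled_zero[OF assms(1)] filled_zero[OF assms(2)]
    by (auto simp: figures_def intro: compact_Int_closed convex_Int)
  moreover have "\<exists>A\<in>H. t *\<^sub>R p \<in> A \<and> A \<subseteq> S \<inter> T"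
    if p: "p \<in> S \<inter> T" and t: "0 \<le> t" "t < 1" for p t
  proof -
    obtain A B where "A \<in> H" "t *\<^sub>R p \<in> A" "A \<subseteq> S" "B \<in> H" "t *\<^sub>R p \<in> B" "B \<subseteq> T"
      using filledD(2)[OF assms(1) _ t, of p] filledD(2)[OF assms(2) _ t, of p] p by blast
    then show ?thesis using meet[of A B] by blast
  qed
  ultimately show ?thesis by (auto simp: filled_def)
qed

section \<open>The Harnack inequality and limits of filled figures\<close>

lemma filled_harnack:
  assumes S: "S \<in> filled H" and y: "y \<noteq> 0"
    and v: "v \<in> (\<Inter>S\<in>H - {{0}}. (*\<^sub>R) (1 / supp S y) ` S)"
  shows "supp S y *\<^sub>R v \<in> S"
proof -
  note F = figuresD[OF filledD(1)[OF S]]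
  have c0: "0 \<le> supp S y"
    using inner_le_supp[OF F(2) filled_zero[OF S], of y] by simp
  obtain p where p: "p \<in> S" "p \<bullet> y = supp S y"
    using supp_attained[OF filledD(1)[OF S]] by blast
  show ?thesis
  proof (rule closed_scaleR_lim[OF F(4)])
    fix t :: real assume t: "0 < t" "t < 1"
    obtain A where A: "A \<in> H" "t *\<^sub>R p \<in> A" "A \<subseteq> S"
      using filledD(2)[OF S p(1), of t] t by auto
    \<comment> \<open>Since \<open>p\<close> maximizes the inner product with \<open>y\<close> over
      \<open>S\<close>, the member \<open>A\<close> filling \<open>S\<close> at \<open>t p\<close>
      has almost the full support value of \<open>S\<close> at \<open>y\<close>.\<close>
    have le: "t * supp S y \<le> supp A y"
      using inner_le_supp[OF figuresD(2)[OF H_D(1)[OF A(1)]] A(2), of y] p(2) by simp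
    show "t *\<^sub>R (supp S y *\<^sub>R v) \<in> S"
    \<comment> \<open>The figure \<open>{0}\<close> is left out of the intersection containing
      \<open>v\<close>, so it needs its own case; there \<open>supp S y\<close> vanishes.\<close>
    proof (cases "A = {0}")
      case True
      then have "p = 0" using A(2) t by simp
      then have "supp S y = 0" using p(2) by simp
      then show ?thesis using filled_zero[OF S] by simp
    next
      case False
      have "v \<in> (*\<^sub>R) (1 / supp A y) ` A" by (rule INT_D[OF v]) (use A(1) False in simp)
      then obtain a where a: "a \<in> A" "v = (1 / supp A y) *\<^sub>R a" by (rule imageE)
      have "supp A y *\<^sub>R v = a" using supp_pos_H[OF A(1) False y] by (simp add: a(2))
      then have "supp A y *\<^sub>R v \<in> S" using a(1) A(3) by (simp add: subsetD)
      then have "(t * supp S y) *\<^sub>R v \<in> S"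
        by (rule scaleR_mem_convex_le[OF F(3) filled_zero[OF S]]) (use le c0 t in auto)
      then show ?thesis by simp
    qed
  qed
qed

text \<open>The Harnack inequality survives pointwise limits, so \<open>T\<close> contains a
  positive multiple of the absorbing set \<open>?G\<close>. Hence the limit cannot flatten to a
  lower-dimensional figure such as a segment.\<close>

lemma filled_limit_interior:
  assumes S: "\<And>n. S n \<in> filled H" and T: "T \<in> figures" "T \<noteq> {0}"
    and lim: "\<And>x. norm x = 1 \<Longrightarrow> (\<lambda>n. supp (S n) x) \<longlonglongrightarrow> supp T x"
  shows "0 \<in> interior T"
proof -
  note F = figuresD[OF T(1)]
  obtain q where q: "q \<in> T" "q \<noteq> 0" using F(1) T(2) by blast
  \<comment> \<open>The direction of a nonzero point of \<open>T\<close> has positive support value;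
    it is a unit vector because \<open>lim\<close> speaks only of those.\<close>
  define y where "y = sgn q"
  have y: "y \<noteq> 0" "norm y = 1" using q(2) by (auto simp: y_def norm_sgn sgn_zero_iff)
  let ?c = "supp T y"
  let ?G = "\<Inter>S\<in>H - {{0}}. (*\<^sub>R) (1 / supp S y) ` S"
  have "0 < q \<bullet> y" using q(2) by (simp add: y_def sgn_div_norm)
  also have "\<dots> \<le> ?c" by (rule inner_le_supp[OF F(2) q(1)])
  finally have c: "0 < ?c" .
  have "?c *\<^sub>R v \<in> T" if v: "v \<in> ?G" for v
  proof (rule mem_figure_if_inner_le[OF T(1)])
    fix x :: "real ^ 'n" assume x: "norm x = 1"
    have "(\<lambda>n. (supp (S n) y *\<^sub>R v) \<bullet> x) \<longlonglongrightarrow> (?c *\<^sub>R v) \<bullet> x"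
      by (intro tendsto_intros lim y)
    moreover have "(supp (S n) y *\<^sub>R v) \<bullet> x \<le> supp (S n) x" for n
      by (rule inner_le_supp[OF figuresD(2)[OF filledD(1)[OF S]] filled_harnack[OF S y(1) v]])
    ultimately show "(?c *\<^sub>R v) \<bullet> x \<le> supp T x"
      by (intro LIMSEQ_le[OF _ lim[OF x]]) auto
  qed
  then have sub: "(*\<^sub>R) ?c ` ?G \<subseteq> T" by (rule image_subsetI)
  have "convex ?G"
    by (intro convex_INT convex_scaling figuresD(3) H_D(1)) simp
  then have "0 \<in> interior ?G" by (rule zero_mem_interior_absorbing[OF _ harnack[OF y(1)]])
  then show ?thesis using zero_mem_interior_scaleR[OF _ _ sub] c by simp
qed

text \<open>With a ball of radius \<open>r\<close> inside \<open>T\<close>, the uniform error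
  \<open>e * r\<close> becomes a relative one: \<open>S n\<close> lies between \<open>T\<close>
  scaled by \<open>1 - e\<close> and by \<open>1 + e\<close>. A member of \<open>H\<close> filling
  \<open>S n\<close> then fills \<open>T\<close> after division by \<open>1 + e\<close>.\<close>

lemma filled_closed: "closed_in_figures (filled H)"
  unfolding closed_in_figures_def
proof (intro allI impI, elim conjE)
  fix S T
  assume S: "\<forall>n. S n \<in> filled H" and T: "T \<in> figures"
    and lim: "uniform_limit (sphere 0 1) (\<lambda>n. supp (S n)) (supp T) sequentially"
  note F = figuresD[OF T]
  show "T \<in> filled H"
  proof (cases "T = {0}")
    case True
    then show ?thesis using subset_filled zero_mem by blast
  next
    case False
    have "0 \<in> interior T"
      by (rule filled_limit_interior[of S, OF _ T False])
        (use S tendsto_uniform_limitI[OF lim] in auto)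
    then obtain r where r: "r > 0" "cball 0 r \<subseteq> T" by (auto simp: mem_interior_cball)
    have rT: "r \<le> supp T x" if "norm x = 1" for x
    proof -
      have "r *\<^sub>R x \<in> T" using r that by (auto simp: subset_iff)
      from inner_le_supp[OF F(2) this, of x] show ?thesis
        using that by (simp flip: power2_norm_eq_inner)
    qed
    have "\<exists>A\<in>H. t *\<^sub>R p \<in> A \<and> A \<subseteq> T" if p: "p \<in> T" and t: "0 \<le> t" "t < 1" for p t
    proof -
      \<comment> \<open>This choice gives \<open>t * (1 + e) < 1 - e\<close>, so the filling factor
        used for \<open>S n\<close> stays below 1.\<close>
      define e where "e = (1 - t) / 2"
      have e: "0 < e" "e < 1" using t by (auto simp: e_def)
      have te: "t * (1 + e) < 1 - e"
      proof -
        have "0 < (1 - t) * (1 - t)" using t by (intro mult_pos_pos) auto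
        then show ?thesis by (simp add: e_def field_simps)
      qed
      obtain n where "\<forall>x\<in>sphere 0 1. dist (supp (S n) x) (supp T x) < e * r"
        using eventually_happens'[OF sequentially_bot
            uniform_limitD[OF lim mult_pos_pos[OF e(1) r(1)]]] by blast
      then have n: "\<bar>supp (S n) x - supp T x\<bar> < e * r" if "norm x = 1" for x
        using that by (simp add: dist_real_def)
      have er: "e * r \<le> e * supp T x" if "norm x = 1" for x
        using rT[OF that] e(1) by (intro mult_left_mono) auto
      have Sn: "S n \<in> filled H" using S by blast
      have "(1 - e) *\<^sub>R p \<in> S n"
      proof (rule mem_figure_if_inner_le[OF filledD(1)[OF Sn]])
        fix x :: "real ^ 'n" assume x: "norm x = 1"
        have "((1 - e) *\<^sub>R p) \<bullet> x \<le> (1 - e) * supp T x"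
          using inner_le_supp[OF F(2) p, of x] e by simp
        also have "\<dots> \<le> supp (S n) x"
          using n[OF x] er[OF x] by (simp add: algebra_simps abs_less_iff)
        finally show "((1 - e) *\<^sub>R p) \<bullet> x \<le> supp (S n) x" .
      qed
      \<comment> \<open>The factor takes \<open>(1 - e) p\<close> to \<open>t (1 + e) p\<close>,
        which the final division by \<open>1 + e\<close> brings to \<open>t p\<close>.\<close>
      from filledD(2)[OF Sn this, of "t * (1 + e) / (1 - e)"]
      obtain A where A: "A \<in> H" "(t * (1 + e)) *\<^sub>R p \<in> A" "A \<subseteq> S n"
        using t e te by (auto simp: divide_simps)
      have "(1 / (1 + e)) *\<^sub>R q \<in> T" if "q \<in> A" for q
      proof (rule mem_figure_if_inner_le[OF T])
        fix x :: "real ^ 'n" assume x: "norm x = 1"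
        have "q \<bullet> x \<le> supp (S n) x"
          using that A(3) by (intro inner_le_supp figuresD(2)[OF filledD(1)[OF Sn]]) auto
        also have "\<dots> \<le> (1 + e) * supp T x"
          using n[OF x] er[OF x] by (simp add: algebra_simps abs_less_iff)
        finally show "((1 / (1 + e)) *\<^sub>R q) \<bullet> x \<le> supp T x"
          using e by (simp add: divide_simps mult.commute)
      qed
      then have "(*\<^sub>R) (1 / (1 + e)) ` A \<subseteq> T" by blast
      moreover have "t *\<^sub>R p \<in> (*\<^sub>R) (1 / (1 + e)) ` A"
        using A(2) e by (intro image_eqI[where x = "(t * (1 + e)) *\<^sub>R p"]) auto
      moreover have "(*\<^sub>R) (1 / (1 + e)) ` A \<in> H" using e by (intro scale A) auto
      ultimately show ?thesis by blast
    qed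
    then show ?thesis using T by (auto simp: filled_def)
  qed
qed

lemma filled_upper_closed: "upper_closed (filled H)"
  using filled_gauges filled_cone filled_closed filled_join by (simp add: upper_closed_def)

section \<open>Minimality of the filled figures\<close>

lemma finite_join_exists:
  assumes "upper_closed K" "finite F" "F \<subseteq> K" "closed S" "convex S" "0 \<in> S"
    and "\<And>A. A \<in> F \<Longrightarrow> A \<subseteq> S"
  shows "\<exists>J\<in>K. \<Union>F \<subseteq> J \<and> J \<subseteq> S"
  using assms(2,3,7)
proof (induction F)
  case empty
  then show ?case
    using assms(1,6) zero_in_cone[of K] by (auto simp: upper_closed_def)
next
  case (insert A F)
  then obtain J where J: "J \<in> K" "\<Union>F \<subseteq> J" "J \<subseteq> S" by auto
  have "join {A, J} \<in> K" using assms(1) insert.prems J(1) by (simp add: upper_closed_def)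
  moreover have "join {A, J} \<subseteq> S"
    using insert.prems J assms by (intro join_pair_least) auto
  moreover have "\<Union>(insert A F) \<subseteq> join {A, J}"
    using J(2) join_upper[of A "{A, J}"] join_upper[of J "{A, J}"] by auto
  ultimately show ?case by blast
qed

text \<open>The interiors of the members of \<open>H\<close> inside \<open>S\<close> cover the
  compact set \<open>t S\<close>. Joining a finite subcover gives an element of \<open>K\<close>
  squeezed between \<open>t S\<close> and \<open>S\<close>.\<close>

lemma filled_approx:
  assumes S: "S \<in> filled H" "S \<noteq> {0}" and K: "upper_closed K" "H \<subseteq> K"
    and t: "0 \<le> t" "t < 1"
  shows "\<exists>J\<in>K. (*\<^sub>R) t ` S \<subseteq> J \<and> J \<subseteq> S"
proof -
  note F = figuresD[OF filledD(1)[OF S(1)]]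
  let ?F = "{A \<in> H. A \<subseteq> S}"
  have cover: "(*\<^sub>R) t ` S \<subseteq> (\<Union>A\<in>?F. interior A)"
  proof clarsimp
    fix p assume p: "p \<in> S"
    \<comment> \<open>A factor strictly between \<open>t\<close> and 1 puts \<open>t p\<close> into
      the interior of \<open>A\<close>, not just into \<open>A\<close>.\<close>
    define s where "s = (1 + t) / 2"
    have s: "t < s" "0 < s" "s < 1" using t by (auto simp: s_def)
    obtain A where A: "A \<in> H" "s *\<^sub>R p \<in> A" "A \<subseteq> S"
      using filledD(2)[OF S(1) p, of s] s by auto
    show "\<exists>A. A \<in> H \<and> A \<subseteq> S \<and> t *\<^sub>R p \<in> interior A"
    \<comment> \<open>The figure \<open>{0}\<close> has no interior; here \<open>p = 0\<close>, and
      any nonzero member of \<open>H\<close> inside \<open>S\<close> serves instead.\<close>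
    proof (cases "A = {0}")
      case True
      then have "p = 0" using A(2) s by simp
      moreover obtain B where B: "B \<in> H" "B \<noteq> {0}" "B \<subseteq> S" using filled_nonzero[OF S] .
      ultimately show ?thesis using H_D(4)[OF B(1,2)] by auto
    next
      case False
      have "(t / s) *\<^sub>R (s *\<^sub>R p) \<in> interior A"
        using A s t closure_subset[of A] H_D(4)[OF A(1) False]
          figuresD(3)[OF H_D(1)[OF A(1)]]
        by (intro scaleR_mem_interior) auto
      then have "t *\<^sub>R p \<in> interior A" using s by simp
      with A(1,3) show ?thesis by blast
    qed
  qed
  obtain F' where F': "F' \<subseteq> ?F" "finite F'" "(*\<^sub>R) t ` S \<subseteq> (\<Union>A\<in>F'. interior A)"
    by (rule compactE_image[OF compact_scaling[OF F(2)] open_interior cover])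
  have "\<exists>J\<in>K. \<Union>F' \<subseteq> J \<and> J \<subseteq> S"
    by (rule finite_join_exists[OF K(1) F'(2) _ F(4,3) filled_zero[OF S(1)]])
      (use F'(1) K(2) in auto)
  moreover have "(\<Union>A\<in>F'. interior A) \<subseteq> \<Union>F'"
    by (rule UN_least) (rule order_trans[OF interior_subset Union_upper])
  with F'(3) have "(*\<^sub>R) t ` S \<subseteq> \<Union>F'" by (rule order_trans)
  ultimately show ?thesis by (meson order_trans)
qed

text \<open>Elements of \<open>K\<close> squeezed between \<open>t n\<close> times \<open>S\<close>
  and \<open>S\<close> converge uniformly to \<open>S\<close> as \<open>t n\<close> tends to 1, and
  \<open>K\<close> is closed.\<close>

lemma filled_least:
  assumes K: "upper_closed K" "H \<subseteq> K"
  shows "filled H \<subseteq> K"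
proof
  fix S assume S: "S \<in> filled H"
  note F = figuresD[OF filledD(1)[OF S]]
  show "S \<in> K"
  proof (cases "S = {0}")
    case True
    then show ?thesis using zero_mem K by blast
  next
    case False
    define t where "t n = 1 - 1 / real (Suc n)" for n
    have t: "0 \<le> t n" "t n < 1" for n by (auto simp: t_def divide_simps)
    have "\<exists>J. \<forall>n. J n \<in> K \<and> (*\<^sub>R) (t n) ` S \<subseteq> J n \<and> J n \<subseteq> S"
      using filled_approx[OF S False K t] by (intro choice allI) blast
    then obtain J where J: "\<And>n. J n \<in> K" "\<And>n. (*\<^sub>R) (t n) ` S \<subseteq> J n" "\<And>n. J n \<subseteq> S"
      by blast
    have JF: "J n \<in> figures" for n
      using J(1) K(1) by (auto simp: upper_closed_def cone_of_figures_def)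
    obtain R where R: "R > 0" "\<And>p. p \<in> S \<Longrightarrow> norm p \<le> R"
      using compact_imp_bounded[OF F(2)] by (auto simp: bounded_pos)
    have est: "\<bar>supp (J n) x - supp S x\<bar> \<le> R * (1 / real (Suc n))" if x: "norm x = 1" for n x
    proof -
      obtain p where p: "p \<in> S" "p \<bullet> x = supp S x"
        using supp_attained[OF filledD(1)[OF S]] by blast
      have "(t n *\<^sub>R p) \<bullet> x \<le> supp (J n) x"
        using J(2) p(1) by (intro inner_le_supp figuresD(2)[OF JF]) auto
      then have "t n * supp S x \<le> supp (J n) x" using p(2) by simp
      moreover have "supp (J n) x \<le> supp S x"
        by (intro supp_mono J figuresD(1)[OF JF] F)
      moreover have "supp S x \<le> R"
        using norm_cauchy_schwarz[of p x] R(2)[OF p(1)] p(2) x by simp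
      then have "supp S x * (1 / real (Suc n)) \<le> R * (1 / real (Suc n))"
        by (intro mult_right_mono) auto
      ultimately show ?thesis by (simp add: t_def algebra_simps abs_le_iff)
    qed
    have "uniform_limit (sphere 0 1) (\<lambda>n. supp (J n)) (supp S) sequentially"
    proof (rule uniform_limitI)
      fix e :: real assume "e > 0"
      have "(\<lambda>n. R * (1 / real (Suc n))) \<longlonglongrightarrow> R * 0"
        by (intro tendsto_mult tendsto_const LIMSEQ_Suc[OF lim_1_over_n])
      then have "eventually (\<lambda>n. R * (1 / real (Suc n)) < e) sequentially"
        using \<open>e > 0\<close> by (intro order_tendstoD(2)) auto
      then show "eventually (\<lambda>n. \<forall>x\<in>sphere 0 1. dist (supp (J n) x) (supp S x) < e) sequentially"
        by (rule eventually_mono) (auto simp: dist_real_def intro: le_less_trans[OF est])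
    qed
    then show ?thesis
      using K(1) J(1) filledD(1)[OF S] by (auto simp: upper_closed_def closed_in_figures_def)
  qed
qed

text \<open>\<open>filled H\<close> is itself an upper closed cone containing \<open>H\<close>,
  which also keeps the hull from degenerating to \<open>UNIV\<close>.\<close>

lemma upper_hull_eq_filled: "upper_hull H = filled H"
  using upper_hull_least[OF filled_upper_closed subset_filled] filled_least by blast

section \<open>The formula for the members of the upper hull\<close>

abbreviation normalized_join :: "real ^ 'n \<Rightarrow> (real ^ 'n) set" where
  "normalized_join x \<equiv> join ((\<lambda>S0. (*\<^sub>R) (1 / supp S0 x) ` S0) ` (H - {{0}}))"

text \<open>The half-space is closed and convex and contains every normalized member of
  \<open>H\<close>, hence also their join.\<close>

lemma normalized_join_inner_le:
  assumes "x \<noteq> 0" "j \<in> normalized_join x"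
  shows "j \<bullet> x \<le> 1"
proof -
  have "normalized_join x \<subseteq> {q. q \<bullet> x \<le> 1}"
    unfolding join_def
  proof (intro closure_minimal hull_minimal)
    show "closed {q. q \<bullet> x \<le> 1}" by (intro closed_Collect_le continuous_intros)
    show "convex {q. q \<bullet> x \<le> 1}" using convex_halfspace_le[of x 1] by (simp add: inner_commute)
    show "\<Union>((\<lambda>S0. (*\<^sub>R) (1 / supp S0 x) ` S0) ` (H - {{0}})) \<subseteq> {q. q \<bullet> x \<le> 1}"
    proof clarsimp
      fix A a assume A: "A \<in> H" "A \<noteq> {0}" "a \<in> A"
      then show "a \<bullet> x / supp A x \<le> 1"
        using supp_pos_H[OF A(1,2) assms(1)] inner_le_supp[OF figuresD(2)[OF H_D(1)] A(3), of x]
        by simp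
    qed
  qed
  with assms(2) show ?thesis by blast
qed

text \<open>
  Since \<open>H\<close> is a convex cone, the union of its members normalized at \<open>x\<close> is already convex.
\<close>
lemma normalized_join_approx:
  assumes "x \<noteq> 0" "j \<in> normalized_join x" "0 \<le> t" "t < 1"
  shows "\<exists>A\<in>H. t *\<^sub>R j \<in> A \<and> supp A x \<le> 1"
proof -
  \<comment> \<open>The bound \<open>supp A x \<le> 1\<close>, instead of equality, also admits the
    figure \<open>{0}\<close>.\<close>
  define U where "U = {z. \<exists>A\<in>H. z \<in> A \<and> supp A x \<le> 1}"
  have sub: "(*\<^sub>R) (1 / supp A x) ` A \<subseteq> U" if A: "A \<in> H" "A \<noteq> {0}" for A
  proof -
    have pos: "0 < supp A x" using supp_pos_H[OF A assms(1)] .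
    have "(*\<^sub>R) (1 / supp A x) ` A \<in> H" using pos by (intro scale A) auto
    moreover have "supp ((*\<^sub>R) (1 / supp A x) ` A) x \<le> 1"
      using pos inner_le_supp[OF figuresD(2)[OF H_D(1)[OF A(1)]], of _ x] figuresD(1)[OF H_D(1)[OF A(1)]]
      by (intro supp_le) auto
    ultimately show ?thesis unfolding U_def by blast
  qed
  have "convex U"
  proof (rule convexI)
    fix a b u v assume ab: "a \<in> U" "b \<in> U" and uv: "0 \<le> u" "0 \<le> v" "u + v = (1::real)"
    obtain A B where AB: "A \<in> H" "a \<in> A" "supp A x \<le> 1" "B \<in> H" "b \<in> B" "supp B x \<le> 1"
      using ab unfolding U_def by blast
    let ?C = "(*\<^sub>R) u ` A + (*\<^sub>R) v ` B"
    have "?C \<in> H" "u *\<^sub>R a + v *\<^sub>R b \<in> ?C" using AB uv by (auto intro: plus scale)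
    moreover have "supp ?C x \<le> 1"
    proof (rule supp_le)
      show "?C \<noteq> {}" using calculation by blast
      fix c assume "c \<in> ?C"
      then obtain a b where c: "a \<in> A" "b \<in> B" "c = u *\<^sub>R a + v *\<^sub>R b"
        by (auto simp: set_plus_def)
      have "a \<bullet> x \<le> 1" "b \<bullet> x \<le> 1"
        using inner_le_supp[OF figuresD(2)[OF H_D(1)[OF AB(1)]] c(1), of x] AB(3)
          inner_le_supp[OF figuresD(2)[OF H_D(1)[OF AB(4)]] c(2), of x] AB(6) by linarith+
      then have "u * (a \<bullet> x) + v * (b \<bullet> x) \<le> 1" by (rule convex_bound_le[OF _ _ uv])
      then show "c \<bullet> x \<le> 1" by (simp add: c(3) inner_add_left)
    qed
    ultimately show "u *\<^sub>R a + v *\<^sub>R b \<in> U" unfolding U_def by blast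
  qed
  then have "convex hull (\<Union>((\<lambda>S0. (*\<^sub>R) (1 / supp S0 x) ` S0) ` (H - {{0}}))) \<subseteq> U"
    using sub by (intro hull_minimal) auto
  then have j: "j \<in> closure U" using assms(2) closure_mono unfolding join_def by blast
  \<comment> \<open>Without a nonzero member, the join of the empty family would be empty and could
    not contain \<open>j\<close>.\<close>
  have "H - {{0}} \<noteq> {}"
  proof
    assume "H - {{0}} = {}"
    with assms(2) show False by (simp add: join_def)
  qed
  then obtain A where A: "A \<in> H" "A \<noteq> {0}" by blast
  have pos: "0 < supp A x" using supp_pos_H[OF A assms(1)] .
  \<comment> \<open>An interior point at 0 lets the factor \<open>t\<close> absorb the closure in
    the join: \<open>t j\<close> lies in \<open>U\<close> itself.\<close>
  have "0 \<in> interior U"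
    using zero_mem_interior_scaleR[OF H_D(4)[OF A] _ sub[OF A]] pos by simp
  then have "t *\<^sub>R j \<in> interior U"
    using assms by (intro scaleR_mem_interior \<open>convex U\<close> j) auto
  then show ?thesis using interior_subset unfolding U_def by blast
qed

text \<open>Support functions decrease under intersection, and the common point \<open>p\<close>
  keeps the intersection nonempty. The index set is nonempty because the induction starts from a
  single member of \<open>H\<close>.\<close>

lemma finite_meet_exists:
  assumes "finite X" "X \<noteq> {}"
    and "\<And>x. x \<in> X \<Longrightarrow> \<exists>A\<in>H. p \<in> A \<and> supp A x \<le> c x"
  shows "\<exists>A\<in>H. p \<in> A \<and> (\<forall>x\<in>X. supp A x \<le> c x)"
  using assms
proof (induction X rule: finite_ne_induct)
  case (insert y X)
  then obtain A B where A: "A \<in> H" "p \<in> A" "\<forall>x\<in>X. supp A x \<le> c x"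
    and B: "B \<in> H" "p \<in> B" "supp B y \<le> c y" by blast
  have "supp (A \<inter> B) x \<le> supp A x" "supp (A \<inter> B) x \<le> supp B x" for x
    using A B figuresD(2)[OF H_D(1)] by (auto intro!: supp_mono)
  with A(3) B(3) have "\<forall>x\<in>insert y X. supp (A \<inter> B) x \<le> c x"
    by (metis insertE order_trans)
  then show ?case using meet[OF A(1) B(1)] A(2) B(2) by blast
qed auto

section \<open>Filled figures and the intersection formula\<close>

lemma zero_mem_normalized_join:
  assumes "A \<in> H" "A \<noteq> {0}"
  shows "0 \<in> normalized_join x"
proof -
  have "(*\<^sub>R) (1 / supp A x) ` A \<subseteq> normalized_join x"
    by (rule join_upper) (use assms in blast)
  then show ?thesis using H_D(3)[OF assms(1)] by (auto simp: image_subset_iff)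
qed

text \<open>If \<open>A\<close> lies inside \<open>S\<close>, dividing \<open>A\<close> by
  \<open>supp S x\<close> shrinks it at least as much as its own normalization does, so it stays in
  the join, which is convex and contains 0.\<close>

lemma filled_subset_normalized_join:
  assumes S: "S \<in> filled H" "S \<noteq> {0}" and x: "x \<noteq> 0"
  shows "S \<subseteq> (*\<^sub>R) (supp S x) ` normalized_join x"
proof
  fix p assume p: "p \<in> S"
  note F = figuresD[OF filledD(1)[OF S(1)]]
  let ?J = "normalized_join x"
  have up: "(*\<^sub>R) (1 / supp A x) ` A \<subseteq> ?J" if "A \<in> H" "A \<noteq> {0}" for A
    by (rule join_upper) (use that in blast)
  have conv: "convex ?J" unfolding join_def by (intro convex_closure convex_convex_hull)
  obtain B where B: "B \<in> H" "B \<noteq> {0}" using filled_nonzero[OF S] by blast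
  have J0: "0 \<in> ?J" by (rule zero_mem_normalized_join[OF B])
  have pos: "0 < supp S x" by (rule supp_pos[OF F(2) filled_zero_interior[OF S] x])
  have "(1 / supp S x) *\<^sub>R p \<in> ?J"
  proof (rule closed_scaleR_lim)
    show "closed ?J" by (simp add: join_def)
    fix t :: real assume t: "0 < t" "t < 1"
    obtain A where A: "A \<in> H" "t *\<^sub>R p \<in> A" "A \<subseteq> S"
      using filledD(2)[OF S(1) p, of t] t by auto
    show "t *\<^sub>R ((1 / supp S x) *\<^sub>R p) \<in> ?J"
    proof (cases "A = {0}")
      case True
      then have "p = 0" using A(2) t by simp
      then show ?thesis using J0 by simp
    next
      case False
      have Apos: "0 < supp A x" by (rule supp_pos_H[OF A(1) False x])
      have "supp A x \<le> supp S x"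
        using A F figuresD(1)[OF H_D(1)[OF A(1)]] by (intro supp_mono)
      then have le: "1 / supp S x \<le> 1 / supp A x" using Apos by (simp add: frac_le)
      have "(1 / supp A x) *\<^sub>R (t *\<^sub>R p) \<in> ?J" using up[OF A(1) False] A(2) by blast
      then have "(1 / supp S x) *\<^sub>R (t *\<^sub>R p) \<in> ?J"
        by (rule scaleR_mem_convex_le[OF conv J0, of "1 / supp A x" "t *\<^sub>R p"])
          (use le pos in auto)
      then show ?thesis by (simp add: mult.commute)
    qed
  qed
  then show "p \<in> (*\<^sub>R) (supp S x) ` ?J"
    using pos by (intro image_eqI[where x = "(1 / supp S x) *\<^sub>R p"]) auto
qed

text \<open>The set with index \<open>x\<close> already forces the inequality
  \<open>q \<bullet> x \<le> supp S x\<close>.\<close>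

lemma Inter_normalized_join_subset:
  assumes "S \<in> figures" "\<And>x. x \<noteq> 0 \<Longrightarrow> 0 \<le> supp S x"
  shows "(\<Inter>x\<in>UNIV - {0}. (*\<^sub>R) (supp S x) ` normalized_join x) \<subseteq> S"
proof
  fix q assume q: "q \<in> (\<Inter>x\<in>UNIV - {0}. (*\<^sub>R) (supp S x) ` normalized_join x)"
  show "q \<in> S"
  proof (rule mem_figure_if_inner_le[OF assms(1)])
    fix x :: "real ^ 'n" assume "norm x = 1"
    then have x: "x \<noteq> 0" by auto
    have "q \<in> (*\<^sub>R) (supp S x) ` normalized_join x" by (rule INT_D[OF q]) (use x in simp)
    then obtain j where j: "q = supp S x *\<^sub>R j" "j \<in> normalized_join x" by (rule imageE)
    show "q \<bullet> x \<le> supp S x"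
      using mult_left_mono[OF normalized_join_inner_le[OF x j(2)] assms(2)[OF x]] by (simp add: j(1))
  qed
qed

text \<open>\<open>sub\<close> is one inclusion of the formula; the other one holds for every figure
  containing 0.\<close>

lemma filled_if_subset_normalized_join:
  assumes S: "S \<in> figures" "S \<noteq> {0}" "0 \<in> S"
    and sub: "\<And>x. x \<noteq> 0 \<Longrightarrow> S \<subseteq> (*\<^sub>R) (supp S x) ` normalized_join x"
  shows "S \<in> filled H"
proof -
  note F = figuresD[OF S(1)]
  have pos: "0 < supp S x" if x: "x \<noteq> 0" for x
  proof -
    have "0 \<le> supp S x" using inner_le_supp[OF F(2) S(3), of x] by simp
    \<comment> \<open>A zero support value would make the right-hand side of \<open>sub\<close> at
      most \<open>{0}\<close>.\<close>
    moreover have "supp S x \<noteq> 0"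
    proof
      assume "supp S x = 0"
      then have "S \<subseteq> {0}" using sub[OF x] by auto
      with S(2,3) show False by blast
    qed
    ultimately show ?thesis by simp
  qed
  have int: "0 \<in> interior S" by (rule zero_mem_interior_if_supp_pos[OF S(1) pos])
  have near: "\<exists>A\<in>H. s *\<^sub>R p \<in> A \<and> supp A x \<le> supp S x"
    if p: "p \<in> S" and s: "0 \<le> s" "s < 1" and x: "x \<noteq> 0" for p s x
  proof -
    obtain j where j: "j \<in> normalized_join x" "p = supp S x *\<^sub>R j"
      using subsetD[OF sub[OF x] p] by (rule imageE)
    obtain A where A: "A \<in> H" "s *\<^sub>R j \<in> A" "supp A x \<le> 1"
      using normalized_join_approx[OF x j(1) s] by blast
    let ?B = "(*\<^sub>R) (supp S x) ` A"
    have "?B \<in> H" using pos[OF x] by (intro scale A) auto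
    moreover have "s *\<^sub>R p \<in> ?B"
      using A(2) j(2) by (intro image_eqI[where x = "s *\<^sub>R j"]) auto
    moreover have "supp ?B x \<le> supp S x"
    proof (rule supp_le)
      show "?B \<noteq> {}" using A(2) by blast
      fix b assume "b \<in> ?B"
      then obtain a where a: "a \<in> A" "b = supp S x *\<^sub>R a" by blast
      have "a \<bullet> x \<le> 1"
        using inner_le_supp[OF figuresD(2)[OF H_D(1)[OF A(1)]] a(1), of x] A(3) by simp
      then show "b \<bullet> x \<le> supp S x" using a(2) pos[OF x] by simp
    qed
    ultimately show ?thesis by blast
  qed
  have "\<exists>A\<in>H. t *\<^sub>R p \<in> A \<and> A \<subseteq> S" if p: "p \<in> S" and t: "0 \<le> t" "t < 1" for p t
  proof -
    \<comment> \<open>The choice keeps \<open>t * (1 + e)\<close> below 1, so there is still room to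
      apply \<open>near\<close> before dividing by \<open>1 + e\<close>.\<close>
    define e where "e = (1 - t) / 2"
    have e: "0 < e" using t by (simp add: e_def)
    have te: "t * (1 + e) < 1"
    proof -
      have "0 < (1 - t) * (2 - t)" using t by (intro mult_pos_pos) auto
      then show ?thesis by (simp add: e_def field_simps)
    qed
    obtain X where X: "finite X" "0 \<notin> X"
      "\<And>q. (\<And>x. x \<in> X \<Longrightarrow> q \<bullet> x \<le> supp S x) \<Longrightarrow> (1 / (1 + e)) *\<^sub>R q \<in> S"
      using finite_halfspaces_approx[OF S(1) int e] by blast
    \<comment> \<open>\<open>X\<close> is not known to be nonempty, so a nonzero direction is added
      to make the finite meet meaningful.\<close>
    obtain x0 :: "real ^ 'n" where x0: "x0 \<noteq> 0" using nonzero_Basis[OF SOME_Basis] by (rule that)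
    have "\<exists>A\<in>H. (t * (1 + e)) *\<^sub>R p \<in> A \<and> supp A x \<le> supp S x" if "x \<in> insert x0 X" for x
      using that x0 X(2) t e te by (intro near p) auto
    then have "\<exists>A\<in>H. (t * (1 + e)) *\<^sub>R p \<in> A \<and> (\<forall>x\<in>insert x0 X. supp A x \<le> supp S x)"
      using X(1) by (intro finite_meet_exists) auto
    then obtain A where A: "A \<in> H" "(t * (1 + e)) *\<^sub>R p \<in> A"
      "\<And>x. x \<in> insert x0 X \<Longrightarrow> supp A x \<le> supp S x"
      by blast
    have "(1 / (1 + e)) *\<^sub>R q \<in> S" if "q \<in> A" for q
      by (rule X(3)[OF order_trans[OF inner_le_supp[OF figuresD(2)[OF H_D(1)[OF A(1)]] that] A(3)]])
        simp
    then have "(*\<^sub>R) (1 / (1 + e)) ` A \<subseteq> S" by blast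
    moreover have "t *\<^sub>R p \<in> (*\<^sub>R) (1 / (1 + e)) ` A"
      using A(2) e by (intro image_eqI[where x = "(t * (1 + e)) *\<^sub>R p"]) auto
    moreover have "(*\<^sub>R) (1 / (1 + e)) ` A \<in> H" using e by (intro scale A) auto
    ultimately show ?thesis by blast
  qed
  then show ?thesis using S(1) by (auto simp: filled_def)
qed

lemma filled_iff_Inter:
  assumes S: "S \<in> figures" "S \<noteq> {0}"
  shows "S \<in> filled H \<longleftrightarrow> S = (\<Inter>x\<in>UNIV - {0}. (*\<^sub>R) (supp S x) ` normalized_join x)"
    (is "_ \<longleftrightarrow> S = ?I")
proof
  assume f: "S \<in> filled H"
  have "0 \<le> supp S x" for x
    using inner_le_supp[OF figuresD(2)[OF S(1)] filled_zero[OF f], of x] by simp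
  then have "?I \<subseteq> S" by (rule Inter_normalized_join_subset[OF S(1)])
  moreover have "S \<subseteq> ?I"
    by (rule INT_greatest) (use filled_subset_normalized_join[OF f S(2)] in simp)
  ultimately show "S = ?I" by (rule antisym[rotated])
next
  assume eq: "S = ?I"
  obtain x0 :: "real ^ 'n" where x0: "x0 \<noteq> 0" using nonzero_Basis[OF SOME_Basis] by (rule that)
  have sub: "S \<subseteq> (*\<^sub>R) (supp S x) ` normalized_join x" if "x \<noteq> 0" for x
    using INT_lower[of x "UNIV - {0}" "\<lambda>x. (*\<^sub>R) (supp S x) ` normalized_join x"] that
    unfolding eq[symmetric] by simp
  \<comment> \<open>Were \<open>{0}\<close> the only member of \<open>H\<close>, the joins and hence
    \<open>S\<close> would be empty. A nonzero member puts 0 into every join, and so into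
    \<open>S\<close>.\<close>
  have "H - {{0}} \<noteq> {}"
  proof
    assume *: "H - {{0}} = {}"
    have "normalized_join x0 = {}" unfolding join_def * by simp
    then show False using sub[OF x0] figuresD(1)[OF S(1)] by simp
  qed
  then have "0 \<in> normalized_join x" for x using zero_mem_normalized_join by blast
  then have "0 \<in> ?I" by (intro INT_I rev_image_eqI[where x = 0]) auto
  then have "0 \<in> S" by (subst eq)
  then show "S \<in> filled H" by (rule filled_if_subset_normalized_join[OF S _ sub])
qed

end

theorem theorem5p2:
  fixes H :: "(real ^ 'n) set set"
  assumes "cone_of_figures H" and "H \<subseteq> gauges" and "H = lower_hull H"
    and "\<And>y. y \<noteq> 0 \<Longrightarrow> absorbing (\<Inter>S\<in>H - {{0}}. (*\<^sub>R) (1 / supp S y) ` S)"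
  shows "(\<forall>A\<in>upper_hull H. \<forall>B\<in>upper_hull H. A \<inter> B \<in> upper_hull H) \<and>
    (\<forall>S\<in>figures. S \<noteq> {0} \<longrightarrow>
      (S \<in> upper_hull H \<longleftrightarrow>
        S = (\<Inter>x\<in>UNIV - {0}. (*\<^sub>R) (supp S x) `
              join ((\<lambda>S0. (*\<^sub>R) (1 / supp S0 x) ` S0) ` (H - {{0}})))))"
proof -
  \<comment> \<open>The fixed-point hypothesis supplies closure under intersection.\<close>
  have "lower_closed H" using lower_hull_fixed_iff[OF assms(2)] assms(3) by blast
  then interpret harnack_cone H
    by unfold_locales (use assms(1,2,4) in \<open>auto simp: lower_closed_def\<close>)
  show ?thesis
    unfolding upper_hull_eq_filled by (intro conjI ballI impI filled_meet filled_iff_Inter)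
qed

end
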